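(* Let $H$ be an arbitrary (finite, simple, nonempty) graph and let $n\in\mathbb{N}$. Then there exists a connected graph $G$ and a root $R_G$ of $G$ with $|V(R_G)|=n$ such that $H$ is isomorphic to $Res(G,R_G)$.
   Context: For a connected finite graph $G$ and a nonempty set $V_0\subseteq V(G)$, the distance partition $\{V_0,V_1,\dots,V_r\}$ of $V(G)$ is defined recursively by $V_{i+1}=\{v\in V(G)\setminus(V_0\cup\dots\cup V_i) : v \text{ is adjacent to some } u\in V_i\}$, with all $V_i$ nonempty; thus $V_i$ is the set of vertices at distance exactly $i$ from $V_0$. The root is the induced subgraph $R_G=\langle V_0\rangle$ and the distance-residual graph is the induced subgraph $Res(G,R_G)=\langle V_r\rangle$ on the last (farthest) class. *)

theory Defs
  imports "Graph_Theory.Digraph_Isomorphism"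
begin

text \<open>
  A finite simple graph is a symmetric digraph without loops and parallel arcs, i.e. an instance
  of the locale \<^locale>\<open>graph\<close>; adjacency is \<^const>\<open>dominates\<close>.
\<close>

fun dist_class :: "('a, 'b) pre_digraph \<Rightarrow> 'a set \<Rightarrow> nat \<Rightarrow> 'a set" where
  "dist_class G V0 0 = V0"
| "dist_class G V0 (Suc i) =
     {v \<in> verts G - (\<Union>j\<in>{..i}. dist_class G V0 j). \<exists>u\<in>dist_class G V0 i. u \<rightarrow>\<^bsub>G\<^esub> v}"

text \<open>
  In a finite graph with nonempty \<open>V0 \<subseteq> verts G\<close> the set below is finite and nonempty, because the
  classes are pairwise disjoint subsets of the vertex set and class 0 is \<open>V0\<close>.
\<close>

definition last_class_index :: "('a, 'b) pre_digraph \<Rightarrow> 'a set \<Rightarrow> nat" where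
  "last_class_index G V0 = Max {i. dist_class G V0 i \<noteq> {}}"

definition is_root :: "('a, 'b) pre_digraph \<Rightarrow> ('a, 'b) pre_digraph \<Rightarrow> bool" where
  "is_root R G \<longleftrightarrow> induced_subgraph R G \<and> verts R \<noteq> {}"

definition distance_residual ::
  "('a, 'b) pre_digraph \<Rightarrow> ('a, 'b) pre_digraph \<Rightarrow> ('a, 'b) pre_digraph" where
  "distance_residual G R = G \<restriction> dist_class G (verts R) (last_class_index G (verts R))"

end

theory Submission
  imports Defs
begin

text \<open>
  Join a copy of \<open>H\<close> to \<open>n\<close> new pairwise non-adjacent vertices, which form the root.
  Every vertex of the copy is then at distance exactly 1 from the root, so the copy of \<open>H\<close> is the
  last distance class.
\<close>

text \<open>Arcs are pairs of vertices, which rules out parallel arcs. Each new edge is added in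
  both directions to keep the digraph symmetric.\<close>

definition cone :: "'a pair_pre_digraph \<Rightarrow> 'a set \<Rightarrow> 'a pair_pre_digraph" where
  "cone P U = \<lparr>pverts = U \<union> pverts P, parcs = parcs P \<union> U \<times> pverts P \<union> pverts P \<times> U\<rparr>"

lemma pverts_cone [simp]: "pverts (cone P U) = U \<union> pverts P"
  and parcs_cone [simp]: "parcs (cone P U) = parcs P \<union> U \<times> pverts P \<union> pverts P \<times> U"
  by (simp_all add: cone_def)

lemma pair_graph_cone:
  assumes "pair_graph P" "finite U" "U \<inter> pverts P = {}"
  shows "pair_graph (cone P U)"
proof -
  interpret pair_graph P by fact
  show ?thesis
    using assms(2,3) arcs_symmetric no_loops' in_arcsD1 in_arcsD2
    by unfold_locales (auto simp: symmetric_def intro!: symI)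
qed

text \<open>A fixed \<open>u0\<close> in \<open>U\<close> is adjacent to all of
  \<open>pverts P\<close>, and reaches the vertices of \<open>U\<close> through one vertex
  \<open>w0\<close> of \<open>P\<close>. By symmetry every vertex reaches \<open>u0\<close>, so any
  two vertices are linked via \<open>u0\<close>.\<close>

lemma connected_cone:
  assumes "pair_graph P" "finite U" "U \<inter> pverts P = {}" "U \<noteq> {}" "pverts P \<noteq> {}"
  shows "Digraph_Component.connected (with_proj (cone P U))"
proof -
  interpret C: pair_graph "cone P U" using assms by (intro pair_graph_cone)
  obtain u0 w0 where u0: "u0 \<in> U" and w0: "w0 \<in> pverts P" using assms by blast
  have w: "u0 \<rightarrow>\<^sup>*\<^bsub>with_proj (cone P U)\<^esub> w" if "w \<in> pverts P" for w
    using that u0 by (intro C.reachable_adjI) simp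
  have "u0 \<rightarrow>\<^sup>*\<^bsub>with_proj (cone P U)\<^esub> x" if "x \<in> U \<union> pverts P" for x
    using that
  proof
    assume "x \<in> U"
    then have "w0 \<rightarrow>\<^sup>*\<^bsub>with_proj (cone P U)\<^esub> x"
      using w0 by (intro C.reachable_adjI) simp
    with w[OF w0] show ?thesis by (rule C.reachable_trans)
  qed (rule w)
  then have "strongly_connected (with_proj (cone P U))"
    using u0 by (intro strongly_connectedI)
      (auto intro: C.reachable_trans[OF C.symmetric_reachable'])
  \<comment> \<open>Connectedness means strong connectedness of the symmetric closure; as the arcs
    are already symmetric, the closure has the same reachability.\<close>
  then show ?thesis
    by (simp add: Digraph_Component.connected_def strongly_connected_def
        C.reachable_mk_symmetric_eq[OF C.sym_arcs])
qed

lemma dist_class_cone_1: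
  assumes "U \<inter> pverts P = {}" "U \<noteq> {}"
  shows "dist_class (with_proj (cone P U)) U (Suc 0) = pverts P"
  using assms by auto

text \<open>Classes 0 and 1 already exhaust the vertices, so the set difference in the recursion
  leaves nothing.\<close>

lemma dist_class_cone_ge_2:
  assumes "U \<inter> pverts P = {}" "U \<noteq> {}"
  shows "dist_class (with_proj (cone P U)) U (Suc (Suc i)) = {}"
proof -
  have "(\<Union>j\<in>{..Suc i}. dist_class (with_proj (cone P U)) U j) \<supseteq> U \<union> pverts P"
    using dist_class_cone_1[OF assms] UN_upper[of 0 "{..Suc i}" "dist_class (with_proj (cone P U)) U"]
      UN_upper[of "Suc 0" "{..Suc i}" "dist_class (with_proj (cone P U)) U"] by simp
  then show ?thesis unfolding dist_class.simps(2)[of _ _ "Suc i"] by auto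
qed

lemma last_class_index_cone:
  assumes "U \<inter> pverts P = {}" "U \<noteq> {}" "pverts P \<noteq> {}"
  shows "last_class_index (with_proj (cone P U)) U = Suc 0"
proof -
  have "dist_class (with_proj (cone P U)) U i \<noteq> {} \<longleftrightarrow> i \<in> {0, Suc 0}" for i
  proof (cases i)
    case (Suc j)
    then show ?thesis
      using assms by (cases j) (simp_all add: dist_class_cone_1 dist_class_cone_ge_2
          del: dist_class.simps(2))
  qed (simp add: assms)
  then have "{i. dist_class (with_proj (cone P U)) U i \<noteq> {}} = {0, Suc 0}" by blast
  then show ?thesis unfolding last_class_index_def by simp
qed

text \<open>This is an equality, not merely an isomorphism: every added arc has an end in
  \<open>U\<close>, hence outside \<open>pverts P\<close>, so inducing on \<open>pverts P\<close>
  removes exactly the added arcs.\<close>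

lemma distance_residual_cone:
  assumes "pair_graph P" "U \<inter> pverts P = {}" "U \<noteq> {}" "pverts P \<noteq> {}" "verts R = U"
  shows "distance_residual (with_proj (cone P U)) R = with_proj P"
proof -
  interpret pair_graph P by fact
  have "{e \<in> parcs (cone P U). fst e \<in> pverts P \<and> snd e \<in> pverts P} = parcs P"
    using assms(2) in_arcsD1 in_arcsD2 by auto
  moreover have "distance_residual (with_proj (cone P U)) R = with_proj (cone P U) \<restriction> pverts P"
    using assms by (simp add: distance_residual_def last_class_index_cone dist_class_cone_1
        del: dist_class.simps(2))
  ultimately show ?thesis
    by (simp add: induce_subgraph_def del: parcs_cone flip: with_proj_def)
qed

text \<open>Moves a graph with arbitrary vertex and arc types to the pair representation on which
  \<open>cone\<close> operates, with control over the new vertex set.\<close>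

lemma (in graph) ex_pair_graph_iso:
  assumes "inj_on f (verts G)"
  shows "\<exists>P. pair_graph P \<and> pverts P = f ` verts G \<and> digraph_iso G (with_proj P)"
proof -
  define h where "h = (\<lambda>a. (f (tail G a), f (head G a)))"
  define P where "P = \<lparr>pverts = f ` verts G, parcs = h ` arcs G\<rparr>"
  have f_eq: "f x = f y \<longleftrightarrow> x = y" if "x \<in> verts G" "y \<in> verts G" for x y
    using assms that by (auto dest: inj_onD)
  \<comment> \<open>Since \<open>f\<close> is injective on the vertices, equal images under
    \<open>h\<close> mean equal ends, and there are no parallel arcs.\<close>
  have "inj_on h (arcs G)"
    by (rule inj_onI) (auto simp: h_def f_eq arc_to_ends_def intro: no_multi_arcs)
  \<comment> \<open>\<open>app_iso\<close> takes head and tail maps from the isomorphism record;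
    choosing \<open>snd\<close> and \<open>fst\<close> makes the image of \<open>G\<close> literally
    \<open>with_proj P\<close>.\<close>
  then have "digraph_iso G (with_proj P)"
    using assms wf_digraph
    by (auto simp: digraph_iso_def digraph_isomorphism_def app_iso_def P_def with_proj_def h_def
        intro!: exI[of _ "\<lparr>iso_verts = f, iso_arcs = h, iso_head = snd, iso_tail = fst\<rparr>"])
  moreover have "pair_graph P"
  proof
    show "symmetric (with_proj P)"
      unfolding symmetric_conv
    proof
      fix e assume "e \<in> arcs (with_proj P)"
      then obtain a where a: "a \<in> arcs G" "e = h a" by (auto simp: P_def)
      obtain b where "b \<in> arcs G" "tail G a = head G b" "head G a = tail G b"
        using sym_arcs a(1) by (auto simp: symmetric_conv)
      with a show "\<exists>e2\<in>arcs (with_proj P). tail (with_proj P) e = head (with_proj P) e2 \<and>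
          head (with_proj P) e = tail (with_proj P) e2"
        by (intro bexI[of _ "h b"]) (auto simp: P_def h_def)
    qed
  qed (auto simp: P_def h_def f_eq dest: no_loops)
  ultimately show ?thesis by (auto simp: P_def)
qed

theorem theorem1:
  fixes H :: "('a, 'b) pre_digraph" and n :: nat
  assumes "graph H" and "verts H \<noteq> {}" and "n \<ge> 1"
  shows "\<exists>(G :: (nat, nat \<times> nat) pre_digraph) R.
           graph G \<and> Digraph_Component.connected G \<and> is_root R G \<and> card (verts R) = n \<and>
           digraph_iso H (distance_residual G R)"
proof -
  interpret H: graph H by fact
  obtain g :: "'a \<Rightarrow> nat" where "inj_on g (verts H)"
    using finite_imp_inj_to_nat_seg[OF H.finite_verts] by blast
  \<comment> \<open>The shift by \<open>n\<close> keeps the numbers below \<open>n\<close> free for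
    the root.\<close>
  then have "inj_on (\<lambda>x. n + g x) (verts H)" by (auto simp: inj_on_def)
  from H.ex_pair_graph_iso[OF this] obtain P where
    P: "pair_graph P" "pverts P = (\<lambda>x. n + g x) ` verts H" "digraph_iso H (with_proj P)"
    by blast
  let ?U = "{..<n}"
  have U: "finite ?U" "?U \<inter> pverts P = {}" "?U \<noteq> {}" "pverts P \<noteq> {}"
    using assms P(2) by (auto simp: lessThan_empty_iff)
  let ?G = "with_proj (cone P ?U)"
  let ?R = "?G \<restriction> ?U"
  interpret G: pair_graph "cone P ?U" using P(1) U by (intro pair_graph_cone)
  have "graph ?G" by unfold_locales
  moreover have "Digraph_Component.connected ?G" using P(1) U by (intro connected_cone)
  moreover have "is_root ?R ?G" using U(3) by (auto simp: is_root_def)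
  moreover have "distance_residual ?G ?R = with_proj P"
    using P(1) U by (intro distance_residual_cone) auto
  ultimately show ?thesis
    using P(3) by (intro exI[of _ ?G] exI[of _ ?R]) simp
qed

end
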